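(* Let $A$ be a set, let $G$ and $H$ be groups, and let $\phi : H \to G$ be a group homomorphism. Let $\tau : A^G \to A^H$ be a map, and equip $A^G$ and $A^H$ with their prodiscrete uniform structures. Then the following conditions are equivalent: (1) $\tau$ is a $\phi$-cellular automaton; (2) $\tau$ is uniformly continuous and $\phi$-equivariant.
   Context: For a group $G$ and a set $A$, $A^G$ is the set of all maps $x : G \to A$ (configurations). The group $G$ acts on $A^G$ on the left by the $G$-shift: $(g\cdot x)(g') = x(g^{-1}g')$ for $g,g' \in G$, $x \in A^G$; similarly $H$ acts on $A^H$. For a group homomorphism $\phi : H \to G$, a $\phi$-cellular automaton from $A^G$ to $A^H$ is a map $\tau : A^G \to A^H$ for which there exist a finite subset $S \subseteq G$ (a memory set) and a map $\mu : A^S \to A$ (a local function) such that $\tau(x)(h) = \mu\big((\phi(h^{-1})\cdot x)|_S\big)$ for all $x \in A^G$ and $h \in H$, where $|_S$ denotes restriction to $S$. A map $\tau : A^G \to A^H$ is $\phi$-equivariant if $\tau(\phi(h)\cdot x) = h\cdot \tau(x)$ for all $h \in H$, $x \in A^G$. The prodiscrete uniform structure on $A^G$ is the product uniform structure where each factor $A$ has the discrete uniform structure; a base of entourages is given by the sets $W_\Omega = \{(x,y) \in A^G \times A^G : x|_\Omega = y|_\Omega\}$, with $\Omega$ ranging over all finite subsets of $G$. The prodiscrete uniform structure on $A^H$ is defined in the same way. *)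

theory Defs
  imports Complex_Main "HOL-Algebra.Group" "HOL-Library.FuncSet"
begin

text \<open>
  The carriers \<open>A\<close>, \<open>carrier G\<close>, \<open>carrier H\<close> are sets, so that \<open>A\<close> may be empty. Maps with a given
  domain, such as the elements of \<open>A\<^sup>G\<close> and \<open>A\<^sup>S\<close>, are extensional functions.
\<close>

definition configs :: "('g, 'm) monoid_scheme \<Rightarrow> 'a set \<Rightarrow> ('g \<Rightarrow> 'a) set" where
  "configs G A = (carrier G \<rightarrow>\<^sub>E A)"

definition shift :: "('g, 'm) monoid_scheme \<Rightarrow> 'g \<Rightarrow> ('g \<Rightarrow> 'a) \<Rightarrow> ('g \<Rightarrow> 'a)" where
  "shift G g x = (\<lambda>g' \<in> carrier G. x (inv\<^bsub>G\<^esub> g \<otimes>\<^bsub>G\<^esub> g'))"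

definition cellular_automaton ::
  "('g, 'm) monoid_scheme \<Rightarrow> ('h, 'n) monoid_scheme \<Rightarrow> ('h \<Rightarrow> 'g) \<Rightarrow> 'a set
     \<Rightarrow> (('g \<Rightarrow> 'a) \<Rightarrow> ('h \<Rightarrow> 'a)) \<Rightarrow> bool" where
  "cellular_automaton G H \<phi> A \<tau> \<longleftrightarrow>
     \<tau> \<in> configs G A \<rightarrow> configs H A \<and>
     (\<exists>S \<mu>. finite S \<and> S \<subseteq> carrier G \<and> \<mu> \<in> (S \<rightarrow>\<^sub>E A) \<rightarrow> A \<and>
        (\<forall>x \<in> configs G A. \<forall>h \<in> carrier H.
           \<tau> x h = \<mu> (restrict (shift G (\<phi> (inv\<^bsub>H\<^esub> h)) x) S)))"

definition equivariant ::
  "('g, 'm) monoid_scheme \<Rightarrow> ('h, 'n) monoid_scheme \<Rightarrow> ('h \<Rightarrow> 'g) \<Rightarrow> 'a set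
     \<Rightarrow> (('g \<Rightarrow> 'a) \<Rightarrow> ('h \<Rightarrow> 'a)) \<Rightarrow> bool" where
  "equivariant G H \<phi> A \<tau> \<longleftrightarrow>
     (\<forall>h \<in> carrier H. \<forall>x \<in> configs G A. \<tau> (shift G (\<phi> h) x) = shift H h (\<tau> x))"

text \<open>
  As in the class \<^class>\<open>uniform_space\<close>, a uniform structure is given by its filter of entourages.
  That class requires the points to form a whole type; here the points form a set \<open>X\<close>, and the
  filter contains \<open>X \<times> X\<close>: the entourages are the \<open>W \<subseteq> X \<times> X\<close> with \<open>eventually (\<lambda>p. p \<in> W)\<close>.
\<close>

definition discrete_uniformity :: "'a set \<Rightarrow> ('a \<times> 'a) filter" where
  "discrete_uniformity A = principal (Id_on A)"

text \<open>The coarsest uniform structure on the product that makes all projections uniformly continuous.\<close>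

definition product_uniformity ::
  "'i set \<Rightarrow> ('i \<Rightarrow> 'a set) \<Rightarrow> ('i \<Rightarrow> ('a \<times> 'a) filter) \<Rightarrow> (('i \<Rightarrow> 'a) \<times> ('i \<Rightarrow> 'a)) filter" where
  "product_uniformity I X U =
     inf (principal (Pi\<^sub>E I X \<times> Pi\<^sub>E I X))
         (INF i\<in>I. filtercomap (\<lambda>(x, y). (x i, y i)) (U i))"

definition prodiscrete_uniformity ::
  "('g, 'm) monoid_scheme \<Rightarrow> 'a set \<Rightarrow> (('g \<Rightarrow> 'a) \<times> ('g \<Rightarrow> 'a)) filter" where
  "prodiscrete_uniformity G A =
     product_uniformity (carrier G) (\<lambda>_. A) (\<lambda>_. discrete_uniformity A)"

definition uniformly_continuous_map ::
  "('x \<times> 'x) filter \<Rightarrow> ('y \<times> 'y) filter \<Rightarrow> ('x \<Rightarrow> 'y) \<Rightarrow> bool" where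
  "uniformly_continuous_map U V f \<longleftrightarrow> filterlim (\<lambda>(x, y). (f x, f y)) V U"

lemma uniformly_continuous_map_iff:
  "uniformly_continuous_map U V f \<longleftrightarrow>
     (\<forall>W. eventually (\<lambda>p. p \<in> W) V \<longrightarrow>
       (\<exists>E. eventually (\<lambda>p. p \<in> E) U \<and> (\<forall>(x, y) \<in> E. (f x, f y) \<in> W)))"
proof
  assume L: "uniformly_continuous_map U V f"
  show "\<forall>W. eventually (\<lambda>p. p \<in> W) V \<longrightarrow>
       (\<exists>E. eventually (\<lambda>p. p \<in> E) U \<and> (\<forall>(x, y) \<in> E. (f x, f y) \<in> W))"
  proof (intro allI impI)
    fix W assume "eventually (\<lambda>p. p \<in> W) V"
    with L have "eventually (\<lambda>p. p \<in> {(x, y). (f x, f y) \<in> W}) U"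
      unfolding uniformly_continuous_map_def filterlim_iff by (auto simp: case_prod_unfold)
    then show "\<exists>E. eventually (\<lambda>p. p \<in> E) U \<and> (\<forall>(x, y) \<in> E. (f x, f y) \<in> W)"
      by (intro exI[of _ "{(x, y). (f x, f y) \<in> W}"]) auto
  qed
next
  assume R: "\<forall>W. eventually (\<lambda>p. p \<in> W) V \<longrightarrow>
       (\<exists>E. eventually (\<lambda>p. p \<in> E) U \<and> (\<forall>(x, y) \<in> E. (f x, f y) \<in> W))"
  show "uniformly_continuous_map U V f"
    unfolding uniformly_continuous_map_def filterlim_iff
  proof (intro allI impI)
    fix P assume "eventually P V"
    then have "eventually (\<lambda>p. p \<in> Collect P) V" by simp
    with R obtain E where E: "eventually (\<lambda>p. p \<in> E) U" "\<forall>(x, y) \<in> E. (f x, f y) \<in> Collect P"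
      by blast
    from E(1) show "eventually (\<lambda>p. P (case p of (x, y) \<Rightarrow> (f x, f y))) U"
      by (rule eventually_mono) (use E(2) in auto)
  qed
qed

text \<open>The sets \<open>W\<^sub>\<Omega>\<close>, for finite \<open>\<Omega>\<close>, form a base of entourages of the prodiscrete uniform structure.\<close>

lemma eventually_prodiscrete_uniformity_iff:
  "eventually (\<lambda>p. p \<in> W) (prodiscrete_uniformity G A) \<longleftrightarrow>
     (\<exists>\<Omega>. finite \<Omega> \<and> \<Omega> \<subseteq> carrier G \<and>
        {(x, y) \<in> configs G A \<times> configs G A. restrict x \<Omega> = restrict y \<Omega>} \<subseteq> W)"
proof -
  let ?X = "configs G A"
  let ?D = "\<lambda>i. {(x, y). (x i, y i) \<in> Id_on A}"
  have fc: "filtercomap (\<lambda>(x, y). (x i, y i)) (discrete_uniformity A) = principal (?D i)"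
    for i
    by (auto simp: discrete_uniformity_def filtercomap_principal vimage_def case_prod_unfold)
  have "eventually (\<lambda>p. p \<in> W) (prodiscrete_uniformity G A) \<longleftrightarrow>
      eventually (\<lambda>p. p \<in> ?X \<times> ?X \<longrightarrow> p \<in> W) (INF i\<in>carrier G. principal (?D i))"
    unfolding prodiscrete_uniformity_def product_uniformity_def fc configs_def
    by (subst inf_commute) (simp add: eventually_inf_principal)
  also have "\<dots> \<longleftrightarrow> (\<exists>\<Omega>\<subseteq>carrier G. finite \<Omega> \<and>
      eventually (\<lambda>p. p \<in> ?X \<times> ?X \<longrightarrow> p \<in> W) (INF i\<in>\<Omega>. principal (?D i)))"
    by (subst eventually_INF) blast
  also have "\<dots> \<longleftrightarrow> (\<exists>\<Omega>. finite \<Omega> \<and> \<Omega> \<subseteq> carrier G \<and> (\<forall>p \<in> \<Inter>i\<in>\<Omega>. ?D i. p \<in> ?X \<times> ?X \<longrightarrow> p \<in> W))"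
    by (auto simp: INF_principal_finite eventually_principal)
  also have "\<dots> \<longleftrightarrow> (\<exists>\<Omega>. finite \<Omega> \<and> \<Omega> \<subseteq> carrier G \<and>
        {(x, y) \<in> ?X \<times> ?X. restrict x \<Omega> = restrict y \<Omega>} \<subseteq> W)"
  proof (intro ex_cong1 conj_cong refl)
    fix \<Omega> assume "\<Omega> \<subseteq> carrier G"
    then have "(x, y) \<in> (\<Inter>i\<in>\<Omega>. ?D i) \<longleftrightarrow> restrict x \<Omega> = restrict y \<Omega>"
      if "x \<in> ?X" "y \<in> ?X" for x y
      using that by (auto simp: configs_def restrict_def fun_eq_iff Id_on_def PiE_iff)
    then show "(\<forall>p \<in> \<Inter>i\<in>\<Omega>. ?D i. p \<in> ?X \<times> ?X \<longrightarrow> p \<in> W) \<longleftrightarrow>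
        {(x, y) \<in> ?X \<times> ?X. restrict x \<Omega> = restrict y \<Omega>} \<subseteq> W"
      by (auto 0 4 simp del: INT_iff)
  qed
  finally show ?thesis .
qed

end

(* A uniformly continuous equivariant map reads the value at the identity of H off a finite window
   S in G, and equivariance transports this rule to every element of H.
   Conversely, a cellular automaton with memory set S computes the values on a finite window
   \<Omega> in H from the finite window \<phi>(\<Omega>) S in G. *)
theory Submission
  imports Defs
begin

lemma (in group) shift_mem_configs:
  assumes "g \<in> carrier G" "x \<in> configs G A"
  shows "shift G g x \<in> configs G A"
  using assms by (auto simp: configs_def shift_def)

lemma (in group) shift_shift:
  assumes "g \<in> carrier G" "h \<in> carrier G"
  shows "shift G g (shift G h x) = shift G (g \<otimes> h) x"
  using assms by (auto simp: shift_def fun_eq_iff inv_mult_group m_assoc)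

text \<open>This moves the value at \<open>g\<close> to the identity, so that a rule for the value
  at the identity turns into a rule for the value at any element.\<close>

lemma (in group) shift_inv_one:
  assumes "g \<in> carrier G"
  shows "shift G (inv g) x \<one> = x g"
  using assms by (simp add: shift_def)

text \<open>The sets \<open>W\<^sub>\<Omega>\<close> form a base on both sides, so uniform
  continuity need only be tested on them. In this form entourages disappear: a finite window of the
  output is determined by a finite window of the input.\<close>

lemma uniformly_continuous_map_prodiscrete_iff:
  assumes "\<tau> \<in> configs G A \<rightarrow> configs H B"
  shows "uniformly_continuous_map (prodiscrete_uniformity G A) (prodiscrete_uniformity H B) \<tau> \<longleftrightarrow>
    (\<forall>\<Omega>. finite \<Omega> \<longrightarrow> \<Omega> \<subseteq> carrier H \<longrightarrow>
      (\<exists>S. finite S \<and> S \<subseteq> carrier G \<and>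
        (\<forall>x \<in> configs G A. \<forall>y \<in> configs G A.
          restrict x S = restrict y S \<longrightarrow> restrict (\<tau> x) \<Omega> = restrict (\<tau> y) \<Omega>)))"
    (is "?L \<longleftrightarrow> ?R")
proof
  assume L: ?L
  show ?R
  proof (intro allI impI)
    fix \<Omega> assume \<Omega>: "finite \<Omega>" "\<Omega> \<subseteq> carrier H"
    let ?W = "{(u, v) \<in> configs H B \<times> configs H B. restrict u \<Omega> = restrict v \<Omega>}"
    have "eventually (\<lambda>p. p \<in> ?W) (prodiscrete_uniformity H B)"
      unfolding eventually_prodiscrete_uniformity_iff using \<Omega> by blast
    with L obtain E where E: "eventually (\<lambda>p. p \<in> E) (prodiscrete_uniformity G A)"
      and EW: "\<forall>(x, y) \<in> E. (\<tau> x, \<tau> y) \<in> ?W"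
      unfolding uniformly_continuous_map_iff by blast
    from E obtain S where "finite S" "S \<subseteq> carrier G"
      and "{(x, y) \<in> configs G A \<times> configs G A. restrict x S = restrict y S} \<subseteq> E"
      unfolding eventually_prodiscrete_uniformity_iff by blast
    with EW show "\<exists>S. finite S \<and> S \<subseteq> carrier G \<and>
        (\<forall>x \<in> configs G A. \<forall>y \<in> configs G A.
          restrict x S = restrict y S \<longrightarrow> restrict (\<tau> x) \<Omega> = restrict (\<tau> y) \<Omega>)"
      by (intro exI[of _ S]) blast
  qed
next
  assume R: ?R
  show ?L
    unfolding uniformly_continuous_map_iff
  proof (intro allI impI)
    fix W assume "eventually (\<lambda>p. p \<in> W) (prodiscrete_uniformity H B)"
    then obtain \<Omega> where \<Omega>: "finite \<Omega>" "\<Omega> \<subseteq> carrier H"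
      and W: "{(u, v) \<in> configs H B \<times> configs H B. restrict u \<Omega> = restrict v \<Omega>} \<subseteq> W"
      unfolding eventually_prodiscrete_uniformity_iff by blast
    from R[rule_format, OF \<Omega>] obtain S where S: "finite S" "S \<subseteq> carrier G"
      and eq: "\<And>x y. x \<in> configs G A \<Longrightarrow> y \<in> configs G A \<Longrightarrow>
        restrict x S = restrict y S \<Longrightarrow> restrict (\<tau> x) \<Omega> = restrict (\<tau> y) \<Omega>"
      by blast
    let ?E = "{(x, y) \<in> configs G A \<times> configs G A. restrict x S = restrict y S}"
    have "eventually (\<lambda>p. p \<in> ?E) (prodiscrete_uniformity G A)"
      unfolding eventually_prodiscrete_uniformity_iff using S by blast
    \<comment> \<open>Agreement on \<open>\<Omega>\<close> comes from \<open>eq\<close>; that both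
      images are configurations over \<open>H\<close> comes from the typing of
      \<open>\<tau>\<close>.\<close>
    moreover have "\<forall>(x, y) \<in> ?E. (\<tau> x, \<tau> y) \<in> W"
      using W eq assms by blast
    ultimately show "\<exists>E. eventually (\<lambda>p. p \<in> E) (prodiscrete_uniformity G A) \<and>
        (\<forall>(x, y) \<in> E. (\<tau> x, \<tau> y) \<in> W)"
      by blast
  qed
qed

lemma cellular_automaton_imp_uniformly_continuous:
  assumes "group G" "group H" "\<phi> \<in> hom H G" "cellular_automaton G H \<phi> A \<tau>"
  shows "uniformly_continuous_map (prodiscrete_uniformity G A) (prodiscrete_uniformity H A) \<tau>"
proof -
  \<comment> \<open>The locale names its source group \<open>G\<close> and its target
    \<open>H\<close>, so the letters are swapped here: \<open>\<phi>.G\<close> gives facts about the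
    group \<open>H\<close>, and \<open>\<phi>.H\<close> facts about \<open>G\<close>.\<close>
  interpret \<phi>: group_hom H G \<phi>
    using assms by (simp add: group_hom_def group_hom_axioms_def)
  from assms(4) obtain S \<mu> where \<tau>: "\<tau> \<in> configs G A \<rightarrow> configs H A"
    and S: "finite S" "S \<subseteq> carrier G"
    and \<mu>: "\<And>x h. x \<in> configs G A \<Longrightarrow> h \<in> carrier H \<Longrightarrow>
      \<tau> x h = \<mu> (restrict (shift G (\<phi> (inv\<^bsub>H\<^esub> h)) x) S)"
    unfolding cellular_automaton_def by blast
  show ?thesis
    unfolding uniformly_continuous_map_prodiscrete_iff[OF \<tau>]
  proof (intro allI impI)
    fix \<Omega> assume \<Omega>: "finite \<Omega>" "\<Omega> \<subseteq> carrier H"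
    let ?T = "(\<lambda>(h, s). \<phi> h \<otimes>\<^bsub>G\<^esub> s) ` (\<Omega> \<times> S)"
    have "finite ?T" "?T \<subseteq> carrier G"
      using S \<Omega> by (auto intro!: \<phi>.H.m_closed \<phi>.hom_closed)
    moreover have "restrict (\<tau> x) \<Omega> = restrict (\<tau> y) \<Omega>"
      if "x \<in> configs G A" "y \<in> configs G A" and eq: "restrict x ?T = restrict y ?T" for x y
    proof (rule restrict_ext)
      fix h assume h: "h \<in> \<Omega>"
      then have hH: "h \<in> carrier H" using \<Omega> by auto
      have "x (\<phi> h \<otimes>\<^bsub>G\<^esub> s) = y (\<phi> h \<otimes>\<^bsub>G\<^esub> s)" if "s \<in> S" for s
        using fun_cong[OF eq, of "\<phi> h \<otimes>\<^bsub>G\<^esub> s"] h that by (auto simp: restrict_def split: if_splits)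
      \<comment> \<open>The two inversions cancel: the shift by \<phi>(h^-1) reads \<open>x\<close>
        at \<phi>(h) s, a point of \<open>?T\<close>.\<close>
      then have "restrict (shift G (\<phi> (inv\<^bsub>H\<^esub> h)) x) S = restrict (shift G (\<phi> (inv\<^bsub>H\<^esub> h)) y) S"
        using S hH by (intro restrict_ext) (auto simp: shift_def)
      then show "\<tau> x h = \<tau> y h"
        using \<mu> that hH by simp
    qed
    ultimately show "\<exists>T. finite T \<and> T \<subseteq> carrier G \<and>
        (\<forall>x \<in> configs G A. \<forall>y \<in> configs G A.
          restrict x T = restrict y T \<longrightarrow> restrict (\<tau> x) \<Omega> = restrict (\<tau> y) \<Omega>)"
      by blast
  qed
qed

text \<open>Both sides at \<open>h\<close> apply \<open>\<mu>\<close> to the same pattern: shifting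
  by \<phi>(k) and then by \<phi>(h^-1) is shifting by \<phi>(h^-1 k), and h^-1 k is the inverse of
  k^-1 h, the point where the shifted output reads \<open>\<tau> x\<close>.\<close>

lemma cellular_automaton_imp_equivariant:
  assumes "group G" "group H" "\<phi> \<in> hom H G" "cellular_automaton G H \<phi> A \<tau>"
  shows "equivariant G H \<phi> A \<tau>"
proof -
  interpret \<phi>: group_hom H G \<phi>
    using assms by (simp add: group_hom_def group_hom_axioms_def)
  from assms(4) obtain S \<mu> where \<tau>: "\<tau> \<in> configs G A \<rightarrow> configs H A"
    and \<mu>: "\<And>x h. x \<in> configs G A \<Longrightarrow> h \<in> carrier H \<Longrightarrow>
      \<tau> x h = \<mu> (restrict (shift G (\<phi> (inv\<^bsub>H\<^esub> h)) x) S)"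
    unfolding cellular_automaton_def by blast
  show ?thesis
    unfolding equivariant_def
  proof (intro ballI)
    fix k x assume k: "k \<in> carrier H" and x: "x \<in> configs G A"
    have kx: "shift G (\<phi> k) x \<in> configs G A"
      using k x by (simp add: \<phi>.H.shift_mem_configs)
    show "\<tau> (shift G (\<phi> k) x) = shift H k (\<tau> x)"
    proof (rule extensionalityI[of _ "carrier H"])
      show "\<tau> (shift G (\<phi> k) x) \<in> extensional (carrier H)"
        using funcset_mem[OF \<tau> kx] by (simp add: configs_def PiE_iff)
      show "shift H k (\<tau> x) \<in> extensional (carrier H)"
        by (simp add: shift_def)
    next
      fix h assume h: "h \<in> carrier H"
      have "inv\<^bsub>H\<^esub> (inv\<^bsub>H\<^esub> k \<otimes>\<^bsub>H\<^esub> h) = inv\<^bsub>H\<^esub> h \<otimes>\<^bsub>H\<^esub> k"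
        using h k by (simp add: \<phi>.G.inv_mult_group)
      \<comment> \<open>Only the shift over \<open>H\<close> is unfolded; the shifts over
        \<open>G\<close> stay folded so that \<open>shift_shift\<close> can compose them. Without
        \<open>hom_inv\<close>, \<phi> of an inverse is kept as it appears in the local
        rule.\<close>
      then show "\<tau> (shift G (\<phi> k) x) h = shift H k (\<tau> x) h"
        using h k x kx by (simp add: \<mu> \<phi>.H.shift_shift shift_def[of H] del: \<phi>.hom_inv)
    qed
  qed
qed

text \<open>The local function extends a pattern to a configuration and takes the value of
  \<open>\<tau>\<close> at the identity. Uniform continuity makes this value independent of the
  extension, so any fixed way of extending will do.\<close>

lemma cellular_automatonI:
  fixes G :: "('g, 'm) monoid_scheme" and \<tau> :: "('g \<Rightarrow> 'a) \<Rightarrow> ('h \<Rightarrow> 'a)"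
  assumes "group G" "group H" "\<phi> \<in> hom H G"
    and \<tau>: "\<tau> \<in> configs G A \<rightarrow> configs H A"
    and uc: "uniformly_continuous_map (prodiscrete_uniformity G A) (prodiscrete_uniformity H A) \<tau>"
    and equiv: "equivariant G H \<phi> A \<tau>"
  shows "cellular_automaton G H \<phi> A \<tau>"
proof -
  interpret \<phi>: group_hom H G \<phi>
    using assms by (simp add: group_hom_def group_hom_axioms_def)
  \<comment> \<open>Uniform continuity is used for this one-point window alone; equivariance handles
    all other points.\<close>
  have fin: "finite {\<one>\<^bsub>H\<^esub>}" "{\<one>\<^bsub>H\<^esub>} \<subseteq> carrier H" by auto
  from uc[unfolded uniformly_continuous_map_prodiscrete_iff[OF \<tau>], rule_format, OF fin]
  obtain T where T: "finite T" "T \<subseteq> carrier G"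
    and eq: "\<And>x y. x \<in> configs G A \<Longrightarrow> y \<in> configs G A \<Longrightarrow>
      restrict x T = restrict y T \<Longrightarrow> restrict (\<tau> x) {\<one>\<^bsub>H\<^esub>} = restrict (\<tau> y) {\<one>\<^bsub>H\<^esub>}"
    by blast
  \<comment> \<open>The identity is added to the memory set so that a pattern \<open>p\<close> on \<open>S\<close> extends to \<open>G\<close> by the
    value \<open>p \<one>\<close>; no default element of \<open>A\<close>, which may be empty, is needed.\<close>
  define S where "S = insert \<one>\<^bsub>G\<^esub> T"
  define ext where "ext p = (\<lambda>g \<in> carrier G. if g \<in> S then p g else p \<one>\<^bsub>G\<^esub>)" for p :: "'g \<Rightarrow> 'a"
  define \<mu> where "\<mu> p = \<tau> (ext p) \<one>\<^bsub>H\<^esub>" for p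
  have S: "finite S" "S \<subseteq> carrier G" "\<one>\<^bsub>G\<^esub> \<in> S" "T \<subseteq> S"
    using T by (auto simp: S_def)
  have ext: "ext p \<in> configs G A" if "p \<in> S \<rightarrow>\<^sub>E A" for p
    using that S by (auto simp: ext_def configs_def)
  have pat: "restrict x S \<in> S \<rightarrow>\<^sub>E A" if "x \<in> configs G A" for x
    using that S by (auto simp: configs_def)
  have "\<mu> \<in> (S \<rightarrow>\<^sub>E A) \<rightarrow> A"
    using ext \<tau> by (auto simp: \<mu>_def configs_def Pi_iff PiE_iff)
  moreover have "\<tau> x h = \<mu> (restrict (shift G (\<phi> (inv\<^bsub>H\<^esub> h)) x) S)"
    if x: "x \<in> configs G A" and h: "h \<in> carrier H" for x h
  proof -
    let ?y = "shift G (\<phi> (inv\<^bsub>H\<^esub> h)) x"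
    have y: "?y \<in> configs G A"
      using x h by (intro \<phi>.H.shift_mem_configs) auto
    \<comment> \<open>Cutting \<open>?y\<close> down to \<open>S\<close> and extending again may
      change it outside \<open>S\<close>, but not on \<open>T\<close>, which is all that the value
      at the identity depends on.\<close>
    have "restrict (ext (restrict ?y S)) T = restrict ?y T"
      using S by (intro restrict_ext) (auto simp: ext_def)
    with y ext pat have "restrict (\<tau> (ext (restrict ?y S))) {\<one>\<^bsub>H\<^esub>} = restrict (\<tau> ?y) {\<one>\<^bsub>H\<^esub>}"
      by (intro eq) auto
    then have "\<mu> (restrict ?y S) = \<tau> ?y \<one>\<^bsub>H\<^esub>"
      unfolding \<mu>_def by (metis restrict_apply' singletonI)
    \<comment> \<open>Equivariance is applied to h^-1, which brings the value of
      \<open>\<tau> x\<close> at \<open>h\<close> to the identity.\<close>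
    also have "\<tau> ?y = shift H (inv\<^bsub>H\<^esub> h) (\<tau> x)"
      using equiv x h unfolding equivariant_def by blast
    also have "\<dots> \<one>\<^bsub>H\<^esub> = \<tau> x h"
      using h by (rule \<phi>.G.shift_inv_one)
    finally show ?thesis ..
  qed
  ultimately show ?thesis
    unfolding cellular_automaton_def using \<tau> S by blast
qed

theorem theorem19:
  fixes G :: "('g, 'm) monoid_scheme" and H :: "('h, 'n) monoid_scheme"
    and \<phi> :: "'h \<Rightarrow> 'g" and A :: "'a set" and \<tau> :: "('g \<Rightarrow> 'a) \<Rightarrow> ('h \<Rightarrow> 'a)"
  assumes "group G" and "group H" and "\<phi> \<in> hom H G"
    and "\<tau> \<in> configs G A \<rightarrow> configs H A"
  shows "cellular_automaton G H \<phi> A \<tau> \<longleftrightarrow>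
    uniformly_continuous_map (prodiscrete_uniformity G A) (prodiscrete_uniformity H A) \<tau> \<and>
    equivariant G H \<phi> A \<tau>"
  using assms cellular_automaton_imp_uniformly_continuous cellular_automaton_imp_equivariant
    cellular_automatonI by blast

end
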